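(* (ii) For every integer $r\ge 3$ and all sufficiently large $n$, $\mathrm{ex}_r(n,C_4)=e_r(F_n)$. (iii) For every integer $k>2$ and all sufficiently large $n$, $\mathrm{ex}_2(n,\{C_4,C_{2k}\})=e_2(F_n)$.
   Context: For a graph $G$ with degree sequence $d_1,\dots,d_n$, $e_r(G)=\sum_i d_i^r$. For a graph $F$ (or a family $\mathcal{F}$ of graphs), $\mathrm{ex}_r(n,F)$ (resp. $\mathrm{ex}_r(n,\mathcal{F})$) is the maximum of $e_r(G)$ over $n$-vertex graphs $G$ containing no copy of $F$ (resp. of any member of $\mathcal{F}$). $C_\ell$ is the cycle of length $\ell$. $F_n$ is the $n$-vertex graph consisting of a vertex of degree $n-1$ together with a largest possible matching on the remaining $n-1$ vertices. *)

theory Defs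
  imports Complex_Main "Graph_Theory.Graph_Theory"
begin

text \<open>
  Following the Graph\_Theory entry, a finite simple graph is a \<open>pair_graph\<close>: a symmetric, loopless
  digraph without parallel arcs. An undirected edge \<open>uv\<close> is thus the pair of arcs \<open>(u,v)\<close>, \<open>(v,u)\<close>,
  and the degree of a vertex is its out-degree. Since only isomorphism classes matter, vertices are
  taken to be natural numbers.
\<close>

definition degree_power_sum :: "nat \<Rightarrow> 'a pair_pre_digraph \<Rightarrow> nat" where
  "degree_power_sum r G = (\<Sum>v\<in>pverts G. out_degree (with_proj G) v ^ r)"

definition contains_copy :: "'a pair_pre_digraph \<Rightarrow> 'b pair_pre_digraph \<Rightarrow> bool" where
  "contains_copy G F \<longleftrightarrow>
     (\<exists>H. subgraph (with_proj H) (with_proj G) \<and> digraph_iso (with_proj F) (with_proj H))"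

text \<open>
  As \<open>\<F>\<close> will not contain edgeless graphs, the maximum is over a nonempty set (which is finite, as
  the values are at most \<open>n * n ^ r\<close>).
\<close>

definition ex_deg :: "nat \<Rightarrow> nat \<Rightarrow> 'b pair_pre_digraph set \<Rightarrow> nat" where
  "ex_deg r n \<F> =
     Max {degree_power_sum r G | G :: nat pair_pre_digraph.
            pair_graph G \<and> card (pverts G) = n \<and> (\<forall>F\<in>\<F>. \<not> contains_copy G F)}"

text \<open>For \<open>l \<ge> 3\<close> this is the cycle of length \<open>l\<close>.\<close>

definition cycle_graph :: "nat \<Rightarrow> nat pair_pre_digraph" where
  "cycle_graph l =
     \<lparr> pverts = {..<l},
       parcs = {(i, j). i < l \<and> j < l \<and> (j = Suc i mod l \<or> i = Suc j mod l)} \<rparr>"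

text \<open>
  The vertex \<open>0\<close> is joined to all others, and \<open>{1,2}, {3,4}, \<dots>\<close> is a matching on the remaining
  \<open>n - 1\<close> vertices that leaves at most one of them (namely \<open>n - 1\<close>, when \<open>n\<close> is even) uncovered.
\<close>

definition friendship_graph :: "nat \<Rightarrow> nat pair_pre_digraph" where
  "friendship_graph n =
     \<lparr> pverts = {..<n},
       parcs = {(u, v). u < n \<and> v < n \<and> u \<noteq> v \<and>
                  (u = 0 \<or> v = 0 \<or> (odd u \<and> v = Suc u) \<or> (odd v \<and> u = Suc v))} \<rparr>"

end

theory Submission
  imports Defs "HOL-Real_Asymp.Real_Asymp" "HOL-Analysis.Convex"
begin

text \<open>
  Let \<open>G\<close> be \<open>C\<^sub>4\<close>-free on \<open>n\<close> vertices and let \<open>x\<close> have degree \<open>n - 1 - t\<close>. Every other vertex has at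
  most one neighbour in \<open>N(x)\<close>, so its degree is at most \<open>2\<close> plus its degree into the \<open>t\<close> vertices
  outside the closed neighbourhood of \<open>x\<close>; counting pairs with a common neighbour bounds the second
  moment of the other degrees by \<open>4(n - 1) + 6t\<^sup>2\<close>. For \<open>1 \<le> t \<le> \<epsilon>n\<close> the resulting
  gain over the degrees \<open>2\<close> in \<open>F\<^sub>n\<close> is less than the loss \<open>(n - 1)\<^sup>r - (n - 1 - t)\<^sup>r\<close>, and for \<open>t = 0\<close> the graph is a subgraph of \<open>F\<^sub>n\<close>.

  It remains to find a vertex of degree at least \<open>(1 - \<epsilon>)n\<close>. For \<open>r \<ge> 3\<close> it exists because the second
  moment of all degrees is at most \<open>n\<^sup>2 + O(n\<^bsup>3/2\<^esup>)\<close>. For \<open>r = 2\<close>, forbidding \<open>C\<^bsub>2k\<^esub>\<close> as well leaves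
  \<open>O(n\<^bsup>7/5\<^esup>)\<close> edges, so vertices of degree below \<open>D = n\<^bsup>0.55\<^esup>\<close> contribute \<open>o(n\<^sup>2)\<close>, while the degrees
  above \<open>D\<close> add up to at most \<open>n(1 + o(1))\<close> by \<open>C\<^sub>4\<close>-freeness; hence one of them is close to \<open>n\<close>.
\<close>

subsection \<open>Degrees in graphs without four-cycles\<close>

text \<open>A four-cycle amounts to two distinct vertices with two common neighbours, so its absence
  is recorded as a codegree bound. Each edge is a pair of arcs, so \<open>card E\<close> is twice
  the number of edges.\<close>

locale c4_free_graph =
  fixes V :: "'a set" and E :: "'a rel"
  assumes finite_V: "finite V" and E_sub: "E \<subseteq> V \<times> V" and sym_E: "sym E" and irrefl_E: "irrefl E"
    and codegree: "u \<noteq> v \<Longrightarrow> card (E `` {u} \<inter> E `` {v}) \<le> 1"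
begin

abbreviation deg :: "'a \<Rightarrow> nat" where
  "deg v \<equiv> card (E `` {v})"

lemma adj_sym: "(u, v) \<in> E \<longleftrightarrow> (v, u) \<in> E"
  using sym_E by (auto dest: symD)

lemma adj_neq: "(u, v) \<in> E \<Longrightarrow> u \<noteq> v"
  using irrefl_E by (auto simp: irrefl_def)

lemma nbs_sub: "E `` A \<subseteq> V"
  using E_sub by auto

lemma finite_nbs [simp]: "finite (E `` A)"
  using nbs_sub finite_V finite_subset by blast

lemma common_nb_unique:
  assumes "(u, a) \<in> E" "(v, a) \<in> E" "(u, b) \<in> E" "(v, b) \<in> E" "u \<noteq> v"
  shows "a = b"
proof -
  have "a \<in> E `` {u} \<inter> E `` {v}" "b \<in> E `` {u} \<inter> E `` {v}"
    using assms by auto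
  then show ?thesis
    using codegree[OF \<open>u \<noteq> v\<close>] finite_nbs by (metis card_le_Suc0_iff_eq finite_Int One_nat_def)
qed

lemma deg_le: "v \<in> V \<Longrightarrow> deg v \<le> card V - 1"
proof -
  assume "v \<in> V"
  have "E `` {v} \<subseteq> V - {v}"
    using nbs_sub adj_neq by blast
  then have "deg v \<le> card (V - {v})"
    using finite_V by (intro card_mono) auto
  then show ?thesis
    using \<open>v \<in> V\<close> finite_V by simp
qed

lemma card_E: "card E = (\<Sum>v\<in>V. deg v)"
proof -
  have "E = Sigma V (\<lambda>v. E `` {v})"
    using E_sub by auto
  then have "card E = card (Sigma V (\<lambda>v. E `` {v}))"
    by simp
  then show ?thesis
    using finite_V by simp
qed

lemma card_nbs_Int:
  assumes "A \<subseteq> V"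
  shows "card (E `` {u} \<inter> A) = (\<Sum>a\<in>A. of_bool (u \<in> E `` {a}))"
proof -
  have "finite A"
    using assms finite_V finite_subset by blast
  moreover have "E `` {u} \<inter> A = {a \<in> A. u \<in> E `` {a}}"
    using adj_sym by auto
  ultimately show ?thesis
    by (simp add: Int_def)
qed

lemma sum_card_nbs_Int:
  assumes "A \<subseteq> V"
  shows "(\<Sum>u\<in>V. card (E `` {u} \<inter> A)) = (\<Sum>a\<in>A. deg a)"
proof -
  have "(\<Sum>u\<in>V. card (E `` {u} \<inter> A)) = (\<Sum>a\<in>A. \<Sum>u\<in>V. of_bool (u \<in> E `` {a}))"
    unfolding card_nbs_Int[OF assms] by (rule sum.swap)
  also have "\<dots> = (\<Sum>a\<in>A. deg a)"
  proof (rule sum.cong)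
    fix a
    have "V \<inter> E `` {a} = E `` {a}"
      using nbs_sub by blast
    then show "(\<Sum>u\<in>V. of_bool (u \<in> E `` {a})) = deg a"
      using finite_V by (simp del: Image_singleton_iff)
  qed auto
  finally show ?thesis .
qed

text \<open>Double counting: the squares count triples \<open>(u, a, b)\<close> with
  \<open>a\<close>, \<open>b\<close> in \<open>A\<close> both adjacent to \<open>u\<close>. A pair
  \<open>a \<noteq> b\<close> admits at most one \<open>u\<close>, a diagonal pair admits
  \<open>deg a\<close>.\<close>

lemma second_moment:
  assumes "A \<subseteq> V"
  shows "(\<Sum>u\<in>V. (card (E `` {u} \<inter> A))\<^sup>2) \<le> (card A)\<^sup>2 + (\<Sum>a\<in>A. deg a)"
proof -
  have fin: "finite A"
    using assms finite_V finite_subset by blast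
  have "(\<Sum>u\<in>V. (card (E `` {u} \<inter> A))\<^sup>2)
      = (\<Sum>u\<in>V. \<Sum>a\<in>A. \<Sum>b\<in>A. of_bool (u \<in> E `` {a} \<inter> E `` {b}))"
    unfolding card_nbs_Int[OF assms] power2_eq_square sum_product
    by (intro sum.cong refl) auto
  also have "\<dots> = (\<Sum>a\<in>A. \<Sum>u\<in>V. \<Sum>b\<in>A. of_bool (u \<in> E `` {a} \<inter> E `` {b}))"
    by (rule sum.swap)
  also have "\<dots> = (\<Sum>a\<in>A. \<Sum>b\<in>A. \<Sum>u\<in>V. of_bool (u \<in> E `` {a} \<inter> E `` {b}))"
    by (intro sum.cong refl sum.swap)
  also have "\<dots> \<le> (\<Sum>a\<in>A. \<Sum>b\<in>A. 1 + (if b = a then deg a else 0))"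
  proof (intro sum_mono)
    fix a b
    have "V \<inter> (E `` {a} \<inter> E `` {b}) = E `` {a} \<inter> E `` {b}"
      using nbs_sub by blast
    then have "(\<Sum>u\<in>V. of_bool (u \<in> E `` {a} \<inter> E `` {b})) = card (E `` {a} \<inter> E `` {b})"
      using finite_V by (simp del: Int_iff Image_singleton_iff)
    then show "(\<Sum>u\<in>V. of_bool (u \<in> E `` {a} \<inter> E `` {b})) \<le> 1 + (if b = a then deg a else 0)"
      using codegree[of a b] by (cases "a = b") auto
  qed
  also have "\<dots> = (card A)\<^sup>2 + (\<Sum>a\<in>A. deg a)"
    using fin by (simp only: sum.distrib sum.delta) (simp add: power2_eq_square)
  finally show ?thesis .
qed

lemma sum_deg_sq_le: "(\<Sum>v\<in>V. (deg v)\<^sup>2) \<le> (card V)\<^sup>2 + (\<Sum>v\<in>V. deg v)"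
proof -
  have "E `` {u} \<inter> V = E `` {u}" for u
    using nbs_sub by blast
  then show ?thesis
    using second_moment[of V] by simp
qed

section \<open>Degrees around a vertex of almost full degree\<close>

text \<open>Let \<open>W\<close> be the \<open>t\<close> vertices outside the closed neighbourhood
  of \<open>x\<close>. Apart from \<open>x\<close> and at most one neighbour of \<open>x\<close>,
  all neighbours of \<open>v\<close> lie in \<open>W\<close>. Vertices of \<open>W\<close> have
  degree at most \<open>t\<close>, which bounds the number of arcs into \<open>W\<close> by
  t^2.\<close>

lemma deg_near_dominating:
  assumes "x \<in> V" and t: "t = card V - 1 - deg x"
  shows "\<And>v. v \<noteq> x \<Longrightarrow> deg v \<le> t + 2"
    and "(\<Sum>v\<in>V - {x}. (deg v)\<^sup>2) \<le> 4 * (card V - 1) + 6 * t\<^sup>2"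
proof -
  define W where "W = V - {x} - E `` {x}"
  have x_notin: "x \<notin> E `` {x}"
    using adj_neq by blast
  have finW: "finite W" and W: "W \<subseteq> V"
    using finite_V by (auto simp: W_def)
  have "card W = card (V - {x}) - deg x"
    unfolding W_def by (rule card_Diff_subset) (use x_notin nbs_sub in auto)
  then have card_W: "card W = t"
    using t assms(1) finite_V by simp
  have deg1: "deg v \<le> 2 + card (E `` {v} \<inter> W)" if "v \<noteq> x" for v
  proof -
    have "E `` {v} \<subseteq> {x} \<union> (E `` {v} \<inter> E `` {x}) \<union> (E `` {v} \<inter> W)"
      using E_sub by (auto simp: W_def)
    then have "deg v \<le> card ({x} \<union> (E `` {v} \<inter> E `` {x}) \<union> (E `` {v} \<inter> W))"
      by (intro card_mono) auto
    also have "\<dots> \<le> card {x} + card (E `` {v} \<inter> E `` {x}) + card (E `` {v} \<inter> W)"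
      by (meson add_le_mono1 card_Un_le le_trans)
    finally show ?thesis
      using codegree[OF that] by simp
  qed
  show "deg v \<le> t + 2" if "v \<noteq> x" for v
  proof -
    have "card (E `` {v} \<inter> W) \<le> t"
      unfolding card_W[symmetric] by (intro card_mono finW) auto
    then show ?thesis
      using deg1[OF that] by simp
  qed
  have degW: "deg w \<le> t" if "w \<in> W" for w
  proof -
    have "E `` {w} \<subseteq> (E `` {w} \<inter> E `` {x}) \<union> (W - {w})"
    proof
      fix y assume "y \<in> E `` {w}"
      then have "(w, y) \<in> E"
        by simp
      then have "y \<in> V" "y \<noteq> w" "y \<noteq> x"
        using E_sub that adj_sym[of x w] adj_neq[of w y] by (auto simp: W_def)
      then show "y \<in> (E `` {w} \<inter> E `` {x}) \<union> (W - {w})"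
        using \<open>(w, y) \<in> E\<close> by (auto simp: W_def)
    qed
    then have "deg w \<le> card ((E `` {w} \<inter> E `` {x}) \<union> (W - {w}))"
      using finW by (intro card_mono) auto
    also have "\<dots> \<le> card (E `` {w} \<inter> E `` {x}) + card (W - {w})"
      by (rule card_Un_le)
    also have "\<dots> \<le> 1 + (t - 1)"
      using codegree[of w x] that card_W finW by (auto simp: W_def)
    finally have "deg w \<le> 1 + (t - 1)" .
    \<comment> \<open>Since \<open>W\<close> contains \<open>w\<close>, the truncated
      \<open>t - 1\<close> is a genuine predecessor.\<close>
    moreover have "t \<noteq> 0"
      using that finW unfolding card_W[symmetric] by (metis card_0_eq empty_iff)
    ultimately show ?thesis
      by simp
  qed
  let ?a = "\<lambda>v. card (E `` {v} \<inter> W)"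
  have sumW: "(\<Sum>w\<in>W. deg w) \<le> t\<^sup>2"
    using sum_bounded_above[of W deg t] degW card_W by (simp add: power2_eq_square)
  have "(\<Sum>v\<in>V - {x}. (deg v)\<^sup>2) \<le> (\<Sum>v\<in>V - {x}. 4 + (4 * ?a v + (?a v)\<^sup>2))"
  proof (rule sum_mono)
    fix v assume "v \<in> V - {x}"
    then have "(deg v)\<^sup>2 \<le> (2 + ?a v)\<^sup>2"
      by (intro power_mono deg1) auto
    then show "(deg v)\<^sup>2 \<le> 4 + (4 * ?a v + (?a v)\<^sup>2)"
      by (simp add: power2_eq_square algebra_simps)
  qed
  also have "\<dots> = 4 * (card V - 1) + (\<Sum>v\<in>V - {x}. 4 * ?a v + (?a v)\<^sup>2)"
    using assms(1) finite_V by (simp add: sum.distrib)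
  also have "\<dots> \<le> 4 * (card V - 1) + (\<Sum>v\<in>V. 4 * ?a v + (?a v)\<^sup>2)"
    using finite_V by (intro add_left_mono sum_mono2) auto
  also have "\<dots> = 4 * (card V - 1) + (4 * (\<Sum>v\<in>V. ?a v) + (\<Sum>v\<in>V. (?a v)\<^sup>2))"
    by (simp add: sum.distrib sum_distrib_left)
  \<comment> \<open>The coefficient 6 is 4 from the linear term plus 2 from
    \<open>second_moment\<close>, whose two summands are each at most t^2.\<close>
  also have "\<dots> \<le> 4 * (card V - 1) + 6 * t\<^sup>2"
    using sumW sum_card_nbs_Int[OF W] second_moment[OF W] card_W by simp
  finally show "(\<Sum>v\<in>V - {x}. (deg v)\<^sup>2) \<le> 4 * (card V - 1) + 6 * t\<^sup>2" .
qed

text \<open>With \<open>t = 0\<close> every other vertex has at most one neighbour besides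
  \<open>x\<close>. If all had one, sending each vertex to it would be a fixed-point-free involution
  \<open>m\<close> on \<open>V - {x}\<close>, whose orbits \<open>C\<close> force this set to have
  even size.\<close>

lemma deg_dominated:
  assumes "x \<in> V" "deg x = card V - 1"
  shows "\<And>v. v \<noteq> x \<Longrightarrow> deg v \<le> 2"
    and "even (card V) \<Longrightarrow> \<exists>v\<in>V - {x}. deg v \<le> 1"
proof -
  show deg2: "deg v \<le> 2" if "v \<noteq> x" for v
    using deg_near_dominating(1)[OF assms(1) refl that] assms(2) by simp
  have "E `` {x} = V - {x}"
    using assms finite_V nbs_sub adj_neq by (intro card_subset_eq) auto
  then have adj_x: "v \<in> V \<Longrightarrow> v \<noteq> x \<Longrightarrow> (v, x) \<in> E" for v
    using adj_sym by blast
  show "\<exists>v\<in>V - {x}. deg v \<le> 1" if "even (card V)"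
  proof (rule ccontr)
    assume "\<not> ?thesis"
    then have deg_eq: "deg v = 2" if "v \<in> V - {x}" for v
      using deg2[of v] that by (metis DiffE One_nat_def insertCI le_Suc_eq numeral_2_eq_2)
    have "\<exists>w. E `` {v} - {x} = {w}" if "v \<in> V - {x}" for v
    proof -
      have "card (E `` {v} - {x}) = 1"
        using deg_eq[OF that] adj_x that by simp
      then show ?thesis
        by (rule card_1_singletonE) blast
    qed
    then obtain m where m: "\<And>v. v \<in> V - {x} \<Longrightarrow> E `` {v} - {x} = {m v}"
      by metis
    have m_in: "m v \<in> V - {x}" "m v \<noteq> v" "m (m v) = v" if "v \<in> V - {x}" for v
    proof -
      have *: "(v, m v) \<in> E" "m v \<noteq> x"
        using m[OF that] by auto
      then show 1: "m v \<in> V - {x}" "m v \<noteq> v"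
        using E_sub adj_neq[OF *(1)] by auto
      have "v \<in> E `` {m v} - {x}"
        using * that adj_sym by auto
      then show "m (m v) = v"
        using m[OF 1(1)] by auto
    qed
    define C where "C = (\<lambda>v. {v, m v}) ` (V - {x})"
    have UC: "\<Union>C = V - {x}"
      using m_in(1) unfolding C_def by blast
    have "2 * card C = card (\<Union>C)"
    proof (rule card_partition)
      show "finite C" "finite (\<Union>C)"
        using finite_V UC by (auto simp: C_def)
      show "card c = 2" if c: "c \<in> C" for c
      proof -
        obtain v where "v \<in> V - {x}" "c = {v, m v}"
          using c by (auto simp: C_def)
        then show ?thesis
          using m_in(2)[of v] by simp
      qed
      have block: "c = {y, m y}" if c: "c \<in> C" and y: "y \<in> c" for c y
      proof -
        obtain v where v: "v \<in> V - {x}" "c = {v, m v}"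
          using c by (auto simp: C_def)
        then show ?thesis
          using y m_in(3)[OF v(1)] by auto
      qed
      show "c1 \<inter> c2 = {}" if c: "c1 \<in> C" "c2 \<in> C" "c1 \<noteq> c2" for c1 c2
      proof (rule ccontr)
        assume "c1 \<inter> c2 \<noteq> {}"
        then obtain y where "y \<in> c1" "y \<in> c2"
          by blast
        then show False
          using block[OF c(1)] block[OF c(2)] c(3) by metis
      qed
    qed
    then have "even (card (V - {x}))"
      using UC by (metis dvd_triv_left)
    then show False
      using that assms(1) finite_V card_gt_0_iff[of V] by (auto simp: even_diff_nat)
  qed
qed

end

subsection \<open>Cycles and friendship graphs\<close>

text \<open>The vertex list of a cycle without its closing repetition. Cycles are built only from
  lists of length at least four, so degenerate lists do not arise.\<close>

definition is_cycle :: "'a rel \<Rightarrow> 'a list \<Rightarrow> bool" where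
  "is_cycle E ps \<longleftrightarrow> distinct ps \<and> successively (\<lambda>u v. (u, v) \<in> E) ps \<and> (last ps, hd ps) \<in> E"

lemma is_cycle_nth:
  assumes "is_cycle E ps" "i < length ps"
  shows "(ps ! i, ps ! (Suc i mod length ps)) \<in> E"
proof (cases "Suc i < length ps")
  case True
  then show ?thesis
    using assms by (auto simp: is_cycle_def successively_conv_nth)
next
  case False
  then have "Suc i = length ps"
    using assms(2) by simp
  then show ?thesis
    using assms diff_Suc_1[of i]
    by (auto simp: is_cycle_def last_conv_nth hd_conv_nth simp flip: length_greater_0_conv)
qed

lemma pair_wf_cycle_graph: "pair_wf_digraph (cycle_graph l)"
  by unfold_locales (auto simp: cycle_graph_def)

text \<open>The copy is the image of the cycle under the map sending \<open>i\<close> to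
  \<open>ps ! i\<close>. Only image arcs are taken, so chords in \<open>G\<close> do no harm;
  symmetry of \<open>G\<close> supplies the backward arcs.\<close>

lemma contains_copy_cycleI:
  assumes G: "pair_graph G" and ps: "is_cycle (parcs G) ps" and "length ps = l" "ps \<noteq> []"
  shows "contains_copy G (cycle_graph l)"
proof -
  interpret pair_graph G by fact
  let ?f = "\<lambda>i. ps ! i"
  let ?H = "\<lparr>pverts = set ps, parcs = map_prod ?f ?f ` parcs (cycle_graph l)\<rparr>"
  let ?hom = "\<lparr>iso_verts = ?f, iso_arcs = map_prod ?f ?f, iso_head = snd, iso_tail = fst\<rparr>"
  have C_sub: "parcs (cycle_graph l) \<subseteq> {..<l} \<times> {..<l}"
    by (auto simp: cycle_graph_def)
  have inj: "inj_on ?f {..<l}"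
    using ps \<open>length ps = l\<close> by (auto simp: is_cycle_def inj_on_def nth_eq_iff_index_eq)
  have f_arcs: "map_prod ?f ?f ` parcs (cycle_graph l) \<subseteq> parcs G"
    using is_cycle_nth[OF ps] \<open>length ps = l\<close> arcs_symmetric
    by (auto simp: cycle_graph_def)
  have f_verts: "set ps = ?f ` {..<l}"
    using \<open>length ps = l\<close> by (auto simp: in_set_conv_nth)
  have wfH: "pair_wf_digraph ?H"
    using C_sub by unfold_locales (auto simp: f_verts)
  have "set ps \<subseteq> pverts G"
  proof
    fix v assume "v \<in> set ps"
    then obtain i where "i < length ps" "v = ps ! i"
      by (auto simp: in_set_conv_nth)
    then show "v \<in> pverts G"
      using is_cycle_nth[OF ps] in_arcsD1 by blast
  qed
  then have "subgraph (with_proj ?H) (with_proj G)"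
    using f_arcs wfH pair_wf_digraph
    by (auto simp: subgraph_def compatible_def wf_digraph_wp_iff)
  moreover have "pre_digraph.digraph_isomorphism (with_proj (cycle_graph l)) ?hom"
    unfolding pre_digraph.digraph_isomorphism_def
  proof (intro conjI ballI)
    show "wf_digraph (with_proj (cycle_graph l))"
      by (simp add: wf_digraph_wp_iff pair_wf_cycle_graph)
    show "inj_on (iso_verts ?hom) (verts (with_proj (cycle_graph l)))"
      using inj by (simp add: cycle_graph_def)
    show "inj_on (iso_arcs ?hom) (arcs (with_proj (cycle_graph l)))"
      using inj_on_subset[OF map_prod_inj_on[OF inj inj] C_sub] by simp
  qed auto
  moreover have "app_iso ?hom (with_proj (cycle_graph l)) = with_proj ?H"
    by (simp add: app_iso_def with_proj_def f_verts) (simp add: cycle_graph_def)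
  ultimately show ?thesis
    unfolding contains_copy_def digraph_iso_def by metis
qed

lemma contains_copy_cycleD:
  assumes "contains_copy G (cycle_graph l)"
  shows "\<exists>f. inj_on f {..<l} \<and> (\<forall>i<l. (f i, f (Suc i mod l)) \<in> parcs G)"
proof -
  obtain H hom where H: "subgraph (with_proj H) (with_proj G)"
    and hom: "pre_digraph.digraph_isomorphism (with_proj (cycle_graph l)) hom"
    and eq: "with_proj H = app_iso hom (with_proj (cycle_graph l))"
    using assms unfolding contains_copy_def digraph_iso_def by metis
  \<comment> \<open>Comparing record fields shows that tail and head in the image are again
    \<open>fst\<close> and \<open>snd\<close>, so the vertex map determines the arc map.\<close>
  have arcs_H: "parcs H = iso_arcs hom ` parcs (cycle_graph l)"
    and proj: "iso_tail hom = fst" "iso_head hom = snd"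
    using arg_cong[OF eq, of arcs] arg_cong[OF eq, of tail] arg_cong[OF eq, of head] by auto
  have "(iso_verts hom i, iso_verts hom (Suc i mod l)) \<in> parcs G" if "i < l" for i
  proof -
    have a: "(i, Suc i mod l) \<in> parcs (cycle_graph l)"
      using that by (auto simp: cycle_graph_def)
    then have "iso_arcs hom (i, Suc i mod l) = (iso_verts hom i, iso_verts hom (Suc i mod l))"
      using hom proj by (auto simp: pre_digraph.digraph_isomorphism_def prod_eq_iff)
    then show ?thesis
      using a arcs_H H by (auto simp: subgraph_def)
  qed
  moreover have "inj_on (iso_verts hom) {..<l}"
    using hom by (simp add: pre_digraph.digraph_isomorphism_def) (simp add: cycle_graph_def)
  ultimately show ?thesis
    by blast
qed

text \<open>Two common neighbours \<open>a\<close>, \<open>b\<close> of \<open>u\<close> and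
  \<open>v\<close> would close up to the four-cycle \<open>[u, a, v, b]\<close>.\<close>

lemma c4_free_graphI:
  fixes G :: "'a pair_pre_digraph"
  assumes "pair_graph G" "\<not> contains_copy G (cycle_graph 4)"
  shows "c4_free_graph (pverts G) (parcs G)"
proof -
  interpret pair_graph G by fact
  show ?thesis
  proof
    show "finite (pverts G)"
      by (rule pair_finite_verts)
    show "parcs G \<subseteq> pverts G \<times> pverts G"
      using wellformed' by auto
    show "sym (parcs G)"
      using arcs_symmetric by (auto intro: symI)
    show "irrefl (parcs G)"
    proof (rule irreflI)
      show "(a, a) \<notin> parcs G" for a
        using pair_no_loops[of "(a, a)"] by auto
    qed
    fix u v :: 'a
    assume "u \<noteq> v"
    have "a = b" if ab: "a \<in> parcs G `` {u} \<inter> parcs G `` {v}" "b \<in> parcs G `` {u} \<inter> parcs G `` {v}" for a b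
    proof (rule ccontr)
      assume "a \<noteq> b"
      have "is_cycle (parcs G) [u, a, v, b]"
        using \<open>u \<noteq> v\<close> \<open>a \<noteq> b\<close> ab arcs_symmetric pair_no_loops unfolding is_cycle_def by fastforce
      then show False
        using contains_copy_cycleI[OF assms(1), of "[u, a, v, b]" 4] assms(2) by simp
    qed
    moreover have "finite (parcs G `` {u} \<inter> parcs G `` {v})"
      using pair_finite_arcs by auto
    ultimately show "card (parcs G `` {u} \<inter> parcs G `` {v}) \<le> 1"
      by (simp add: card_le_Suc0_iff_eq)
  qed
qed

lemma degree_power_sum_eq: "degree_power_sum r G = (\<Sum>v\<in>pverts G. card (parcs G `` {v}) ^ r)"
proof -
  have "out_arcs (with_proj G) v = Pair v ` (parcs G `` {v})" for v
    by (auto simp: out_arcs_def)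
  then have "out_degree (with_proj G) v = card (parcs G `` {v})" for v
    by (simp add: out_degree_def card_image inj_on_def)
  then show ?thesis
    by (simp add: degree_power_sum_def)
qed

section \<open>Friendship graphs: absence of long cycles, degree sums, extremality\<close>

lemma pair_graph_friendship: "pair_graph (friendship_graph n)"
  by unfold_locales
    (auto simp: friendship_graph_def symmetric_def sym_def intro: finite_subset[of _ "{..<n} \<times> {..<n}"])

text \<open>Off the hub \<open>0\<close> the graph is a matching, so no path on three vertices
  avoids \<open>0\<close>, whereas a cycle of length at least four has three consecutive vertices
  other than \<open>0\<close>.\<close>

lemma not_contains_copy_friendship:
  assumes "4 \<le> l"
  shows "\<not> contains_copy (friendship_graph n) (cycle_graph l)"
proof
  assume "contains_copy (friendship_graph n) (cycle_graph l)"
  then obtain f where inj: "inj_on f {..<l}"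
    and adj: "\<And>i. i < l \<Longrightarrow> (f i, f (Suc i mod l)) \<in> parcs (friendship_graph n)"
    using contains_copy_cycleD by blast
  \<comment> \<open>The periodic extension of \<open>f\<close> allows reading past the last index
    without wrap-around cases.\<close>
  define g where "g i = f (i mod l)" for i
  have g_adj: "(g i, g (Suc i)) \<in> parcs (friendship_graph n)" for i
    using adj[of "i mod l"] assms by (simp add: g_def mod_Suc_eq)
  have g_neq: "g (j + a) \<noteq> g (j + b)" if "a < b" "b < 4" for j a b
  proof
    assume "g (j + a) = g (j + b)"
    then have "(j + a) mod l = (j + b) mod l"
      using inj assms by (auto simp: g_def inj_on_def)
    then have "l dvd (j + b) - (j + a)"
      using that by (metis mod_eq_dvd_iff_nat add_left_mono less_imp_le)
    then have "l \<le> (j + b) - (j + a)"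
      using that by (intro dvd_imp_le) auto
    then show False
      using that assms by simp
  qed
  \<comment> \<open>If \<open>0\<close> occurs on the cycle, the three vertices after it differ from
    it, as four consecutive vertices are distinct.\<close>
  obtain j where j: "g (j + 1) \<noteq> 0" "g (j + 2) \<noteq> 0" "g (j + 3) \<noteq> 0"
  proof (cases "\<exists>j. g j = 0")
    case True
    then obtain j where "g j = 0"
      by blast
    then have "g (j + 1) \<noteq> 0" "g (j + 2) \<noteq> 0" "g (j + 3) \<noteq> 0"
      using g_neq[of 0 1 j] g_neq[of 0 2 j] g_neq[of 0 3 j] by auto
    then show ?thesis
      by (rule that)
  next
    case False
    then show ?thesis
      by (intro that[of 0]) auto
  qed
  have "u = w" if "(u, v) \<in> parcs (friendship_graph n)" "(v, w) \<in> parcs (friendship_graph n)"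
    "u \<noteq> 0" "v \<noteq> 0" "w \<noteq> 0" for u v w
    using that by (auto simp: friendship_graph_def)
  moreover have "(g (j + 1), g (j + 2)) \<in> parcs (friendship_graph n)"
    "(g (j + 2), g (j + 3)) \<in> parcs (friendship_graph n)"
    using g_adj[of "j + 1"] g_adj[of "j + 2"] by (simp_all add: numeral_eq_Suc)
  ultimately have "g (j + 1) = g (j + 3)"
    using j by blast
  then show False
    using g_neq[of 1 3 j] by simp
qed

lemma degree_power_sum_friendship:
  assumes "n > 0"
  shows "odd n \<Longrightarrow> degree_power_sum r (friendship_graph n) = (n - 1) ^ r + (n - 1) * 2 ^ r"
    and "even n \<Longrightarrow> degree_power_sum r (friendship_graph n) = (n - 1) ^ r + (n - 2) * 2 ^ r + 1"
proof -
  let ?E = "parcs (friendship_graph n)"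
  have "?E `` {0} = {1..<n}"
    using assms by (auto simp: friendship_graph_def)
  then have deg0: "card (?E `` {0}) = n - 1"
    by simp
  \<comment> \<open>The exception is the vertex \<open>n - 1\<close> for even \<open>n\<close>: its
    partner in the matching would be \<open>n\<close>.\<close>
  have deg: "card (?E `` {v}) = (if odd v \<and> Suc v = n then 1 else 2)" if "v \<in> {1..<n}" for v
  proof -
    have "?E `` {v} = (if odd v \<and> Suc v = n then {0} else if odd v then {0, Suc v} else {0, v - 1})"
      using that by (auto simp: friendship_graph_def elim: oddE)
    then show ?thesis
      using that by (auto elim: evenE)
  qed
  have split: "degree_power_sum r (friendship_graph n)
      = (n - 1) ^ r + (\<Sum>v\<in>{1..<n}. (if odd v \<and> Suc v = n then 1 else 2) ^ r)"
  proof -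
    have "{..<n} = insert 0 {1..<n}"
      using assms by auto
    then have "degree_power_sum r (friendship_graph n)
        = (n - 1) ^ r + (\<Sum>v\<in>{1..<n}. card (?E `` {v}) ^ r)"
      using deg0 by (simp add: degree_power_sum_eq) (simp add: friendship_graph_def)
    then show ?thesis
      using deg by simp
  qed
  show "degree_power_sum r (friendship_graph n) = (n - 1) ^ r + (n - 1) * 2 ^ r" if "odd n"
  proof -
    have "(\<Sum>v\<in>{1..<n}. (if odd v \<and> Suc v = n then 1 else 2) ^ r) = (\<Sum>v\<in>{1..<n}. 2 ^ r :: nat)"
      using that by (intro sum.cong) auto
    then show ?thesis
      using split by simp
  qed
  show "degree_power_sum r (friendship_graph n) = (n - 1) ^ r + (n - 2) * 2 ^ r + 1" if "even n"
  proof -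
    have "{1..<n} = insert (n - 1) {1..<n - 1}"
      using that assms by (auto elim!: evenE)
    moreover have "odd (n - 1)" "Suc (n - 1) = n"
      using that assms by auto
    moreover have "(\<Sum>v\<in>{1..<n - 1}. (if odd v \<and> Suc v = n then 1 else 2) ^ r)
        = (\<Sum>v\<in>{1..<n - 1}. 2 ^ r :: nat)"
      by (intro sum.cong) auto
    ultimately show ?thesis
      using split by (simp add: numeral_2_eq_2)
  qed
qed

text \<open>Friendship graphs have no cycle of length at least four, so they compete in the maximum
  and only the upper bound is left. That bound also makes the set of values finite, as
  \<open>Max\<close> requires.\<close>

lemma ex_deg_eq_friendshipI:
  assumes "n > 0" and long: "\<And>F. F \<in> \<F> \<Longrightarrow> \<exists>l\<ge>4. F = cycle_graph l"
    and upper: "\<And>G :: nat pair_pre_digraph. pair_graph G \<Longrightarrow> card (pverts G) = n \<Longrightarrow>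
      \<forall>F\<in>\<F>. \<not> contains_copy G F \<Longrightarrow> degree_power_sum r G \<le> degree_power_sum r (friendship_graph n)"
  shows "ex_deg r n \<F> = degree_power_sum r (friendship_graph n)"
  unfolding ex_deg_def
proof (rule Max_eqI)
  let ?S = "{degree_power_sum r G | G :: nat pair_pre_digraph.
    pair_graph G \<and> card (pverts G) = n \<and> (\<forall>F\<in>\<F>. \<not> contains_copy G F)}"
  show le: "y \<le> degree_power_sum r (friendship_graph n)" if "y \<in> ?S" for y
    using that upper by auto
  show "finite ?S"
    by (rule finite_subset[of _ "{..degree_power_sum r (friendship_graph n)}"]) (use le in auto)
  have "card (pverts (friendship_graph n)) = n"
    by (simp add: friendship_graph_def)
  moreover have "\<forall>F\<in>\<F>. \<not> contains_copy (friendship_graph n) F"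
    using long not_contains_copy_friendship by blast
  ultimately show "degree_power_sum r (friendship_graph n) \<in> ?S"
    using pair_graph_friendship by blast
qed

subsection \<open>Even cycles in dense graphs without four-cycles\<close>

text \<open>
  Deleting a vertex of degree at most \<open>d\<close> preserves \<open>d * (card A + card B) < card R\<close>.
\<close>

lemma bipartite_core:
  assumes "finite A" "finite B" "R \<subseteq> A \<times> B" "d * (card A + card B) < card R"
  shows "\<exists>A' B'. A' \<subseteq> A \<and> B' \<subseteq> B \<and> A' \<noteq> {} \<and>
    (\<forall>a\<in>A'. d < card (R `` {a} \<inter> B')) \<and> (\<forall>b\<in>B'. d < card (R\<inverse> `` {b} \<inter> A'))"
  using assms
proof (induction "card A + card B" arbitrary: A B R rule: less_induct)
  case less
  have finR: "finite R"
    using less.prems finite_subset by blast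
  consider (core) "\<forall>a\<in>A. d < card (R `` {a} \<inter> B)" "\<forall>b\<in>B. d < card (R\<inverse> `` {b} \<inter> A)"
    | (left) a where "a \<in> A" "card (R `` {a} \<inter> B) \<le> d"
    | (right) b where "b \<in> B" "card (R\<inverse> `` {b} \<inter> A) \<le> d"
    by (meson not_le)
  then show ?case
  proof cases
    case core
    \<comment> \<open>The strict inequality makes \<open>R\<close> nonempty.\<close>
    moreover have "A \<noteq> {}"
      using less.prems by auto
    ultimately show ?thesis
      by blast
  next
    case left
    let ?S = "Pair a ` (R `` {a} \<inter> B)"
    have fins: "finite (R `` {a} \<inter> B)"
      using less.prems by simp
    have "card R \<le> card (R - ?S) + card ?S"
    proof -
      have "card R \<le> card ((R - ?S) \<union> ?S)"
        using finR fins by (intro card_mono) auto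
      then show ?thesis
        using card_Un_le le_trans by blast
    qed
    also have "card ?S \<le> d"
      using left card_image_le[OF fins] le_trans by blast
    finally have "card R \<le> card (R - ?S) + d"
      by simp
    moreover have cA: "Suc (card (A - {a})) = card A"
      using left less.prems by (intro card_Suc_Diff1) auto
    ultimately have "d * (card (A - {a}) + card B) < card (R - ?S)"
      using less.prems(4) by (simp add: algebra_simps flip: cA)
    moreover have "R - ?S \<subseteq> (A - {a}) \<times> B"
      using less.prems by auto
    ultimately obtain A' B' where *: "A' \<subseteq> A - {a}" "B' \<subseteq> B" "A' \<noteq> {}"
      "\<forall>a'\<in>A'. d < card ((R - ?S) `` {a'} \<inter> B')" "\<forall>b\<in>B'. d < card ((R - ?S)\<inverse> `` {b} \<inter> A')"
      using less.hyps[of "A - {a}" B "R - ?S"] less.prems(1,2) cA by auto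
    \<comment> \<open>The deleted arcs all start at \<open>a\<close>, which is not in
      \<open>A'\<close>, so core degrees may be read in \<open>R\<close>.\<close>
    have "(R - ?S) `` {a'} \<inter> B' = R `` {a'} \<inter> B'" if "a' \<in> A'" for a'
      using * that by auto
    moreover have "(R - ?S)\<inverse> `` {b} \<inter> A' = R\<inverse> `` {b} \<inter> A'" for b
      using * by auto
    ultimately show ?thesis
      using * by (intro exI[of _ A'] exI[of _ B']) auto
  next
    case right
    let ?S = "(\<lambda>a. (a, b)) ` (R\<inverse> `` {b} \<inter> A)"
    have fins: "finite (R\<inverse> `` {b} \<inter> A)"
      using less.prems by simp
    have "card R \<le> card (R - ?S) + card ?S"
    proof -
      have "card R \<le> card ((R - ?S) \<union> ?S)"
        using finR fins by (intro card_mono) auto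
      then show ?thesis
        using card_Un_le le_trans by blast
    qed
    also have "card ?S \<le> d"
      using right card_image_le[OF fins] le_trans by blast
    finally have "card R \<le> card (R - ?S) + d"
      by simp
    moreover have cB: "Suc (card (B - {b})) = card B"
      using right less.prems by (intro card_Suc_Diff1) auto
    ultimately have "d * (card A + card (B - {b})) < card (R - ?S)"
      using less.prems(4) by (simp add: algebra_simps flip: cB)
    moreover have "R - ?S \<subseteq> A \<times> (B - {b})"
      using less.prems by auto
    ultimately obtain A' B' where *: "A' \<subseteq> A" "B' \<subseteq> B - {b}" "A' \<noteq> {}"
      "\<forall>a'\<in>A'. d < card ((R - ?S) `` {a'} \<inter> B')" "\<forall>b\<in>B'. d < card ((R - ?S)\<inverse> `` {b} \<inter> A')"
      using less.hyps[of A "B - {b}" "R - ?S"] less.prems(1,2) cB by auto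
    have "(R - ?S) `` {a'} \<inter> B' = R `` {a'} \<inter> B'" for a'
      using * by auto
    moreover have "(R - ?S)\<inverse> `` {b'} \<inter> A' = R\<inverse> `` {b'} \<inter> A'" if "b' \<in> B'" for b'
      using * that by auto
    ultimately show ?thesis
      using * by (intro exI[of _ A'] exI[of _ B']) auto
  qed
qed

lemma exists_notin_if_card_less:
  assumes "finite T" "card T < card S"
  shows "\<exists>s\<in>S. s \<notin> T"
proof (rule ccontr)
  assume "\<not> ?thesis"
  then have "card S \<le> card T"
    using assms(1) by (intro card_mono) auto
  then show False
    using assms(2) by simp
qed

context c4_free_graph
begin

text \<open>Greedy extension: each round prepends some \<open>q\<close> in \<open>Q\<close> and
  \<open>p'\<close> in \<open>P\<close>. Fixing the last vertex \<open>p\<close> and steering the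
  first one away from the neighbours of \<open>a\<close> serves to close a cycle later. For
  \<open>j = 0\<close> the first vertex is \<open>p\<close> itself, hence the proviso
  \<open>j > 0\<close>.\<close>

lemma alternating_path:
  assumes PQ: "P \<subseteq> V" "Q \<subseteq> V"
    and Pdeg: "\<And>p. p \<in> P \<Longrightarrow> d < card (E `` {p} \<inter> Q)"
    and Qdeg: "\<And>q. q \<in> Q \<Longrightarrow> d < card (E `` {q} \<inter> P)"
    and "p \<in> P" "a \<notin> Q" "2 * j + 1 \<le> d"
  shows "\<exists>ps. length ps = 2 * j + 1 \<and> distinct ps \<and> successively (\<lambda>u v. (u, v) \<in> E) ps \<and>
    set ps \<subseteq> P \<union> Q \<and> last ps = p \<and> hd ps \<in> P \<and> (j > 0 \<longrightarrow> (a, hd ps) \<notin> E)"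
  using \<open>2 * j + 1 \<le> d\<close>
proof (induction j)
  case 0
  show ?case
    using \<open>p \<in> P\<close> by (intro exI[of _ "[p]"]) auto
next
  case (Suc j)
  then obtain ps where ps: "length ps = 2 * j + 1" "distinct ps"
    "successively (\<lambda>u v. (u, v) \<in> E) ps" "set ps \<subseteq> P \<union> Q" "last ps = p" "hd ps \<in> P"
    by auto
  have "card (set ps) < card (E `` {hd ps} \<inter> Q)"
    using Pdeg[OF ps(6)] Suc.prems ps(1) card_length[of ps] by simp
  then obtain q where "q \<in> E `` {hd ps} \<inter> Q" "q \<notin> set ps"
    using exists_notin_if_card_less[OF finite_set] by meson
  then have q: "q \<in> Q" "(hd ps, q) \<in> E" "q \<notin> set ps"
    by auto
  \<comment> \<open>Forbidden for \<open>p'\<close> are the \<open>2 * j + 2\<close> vertices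
    already chosen and the common neighbours of \<open>q\<close> and \<open>a\<close>, at most one
    because \<open>q \<noteq> a\<close>: in total at most
    \<open>2 * Suc j + 1 \<le> d\<close>.\<close>
  let ?T = "set (q # ps) \<union> (E `` {q} \<inter> E `` {a})"
  have "card ?T \<le> card (set (q # ps)) + card (E `` {q} \<inter> E `` {a})"
    by (rule card_Un_le)
  also have "\<dots> \<le> (2 * j + 2) + 1"
    using codegree[of q a] q(1) \<open>a \<notin> Q\<close> ps(1) card_length[of "q # ps"]
    by (intro add_mono) auto
  also have "\<dots> < card (E `` {q} \<inter> P)"
    using Qdeg[OF q(1)] Suc.prems by simp
  finally have "card ?T < card (E `` {q} \<inter> P)" .
  then obtain p' where "p' \<in> E `` {q} \<inter> P" "p' \<notin> ?T"
    using exists_notin_if_card_less[of ?T] by (meson finite_Int finite_Un finite_nbs finite_set)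
  then have p': "p' \<in> P" "(q, p') \<in> E" "p' \<notin> set (q # ps)" "(a, p') \<notin> E"
    by auto
  have "ps \<noteq> []"
    using ps(1) by auto
  then show ?case
    using ps q p' adj_sym by (intro exI[of _ "p' # q # ps"]) (auto simp: successively_Cons)
qed

text \<open>
  The bipartite double cover of the graph has a core \<open>A', B'\<close> of minimum degree above \<open>d\<close>. From
  \<open>x \<in> A'\<close>, two steps inside the core reach about \<open>d\<^sup>2\<close> vertices \<open>N2\<close>, each coming from exactly one
  neighbour of \<open>x\<close>, so that about \<open>d\<^sup>3\<close> arcs leave \<open>N2\<close>. A core of these arcs contains a path of
  length \<open>2k - 4\<close> whose end points lie in \<open>N2\<close>, behind different neighbours of \<open>x\<close>.
\<close>

lemma exists_even_cycle:
  assumes k: "k > 2"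
    and dense: "2 * d * card V < (\<Sum>v\<in>V. deg v)"
    and d: "4 * k * card V < (d + 1) * (d - 1) * d"
  shows "\<exists>ps. length ps = 2 * k \<and> is_cycle E ps"
proof -
  have "d * (card V + card V) < card E"
    using dense by (simp add: card_E algebra_simps)
  from bipartite_core[OF finite_V finite_V E_sub this]
  obtain A' B' where AB: "A' \<subseteq> V" "B' \<subseteq> V" "A' \<noteq> {}"
    "\<forall>a\<in>A'. d < card (E `` {a} \<inter> B')" "\<forall>b\<in>B'. d < card (E\<inverse> `` {b} \<inter> A')"
    by (elim exE conjE) (rule that)
  have conv: "E\<inverse> = E"
    using adj_sym by auto
  obtain x where x: "x \<in> A'"
    using AB by blast
  define N where "N = E `` {x}"
  define br where "br = (\<lambda>a. (E `` {a} \<inter> A') - N - {x})"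
  define N2 where "N2 = (\<Union>a\<in>N \<inter> B'. br a)"
  define Y where "Y = V - N - {x}"
  define R where "R = E \<inter> N2 \<times> Y"
  have fin: "finite N" "finite (br a)" "finite N2" "finite Y" for a
    using finite_V AB finite_subset by (auto simp: N_def br_def N2_def Y_def)
  have N2_sub: "N2 \<subseteq> A'" "N2 \<subseteq> Y"
    using AB by (auto simp: N2_def br_def Y_def)
  have small: "card (E `` {u} \<inter> N) \<le> 1" if "u \<noteq> x" for u
    using codegree[OF that] by (simp add: N_def)
  \<comment> \<open>Of more than \<open>d\<close> core neighbours of \<open>a\<close>, one is
    \<open>x\<close> and at most one more lies in \<open>N\<close>.\<close>
  have card_br: "d - 1 \<le> card (br a)" if "a \<in> N \<inter> B'" for a
  proof -
    have "a \<noteq> x"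
      using that adj_neq by (auto simp: N_def)
    have "E `` {a} \<inter> A' \<subseteq> br a \<union> (E `` {a} \<inter> N) \<union> {x}"
      by (auto simp: br_def)
    then have "card (E `` {a} \<inter> A') \<le> card (br a \<union> (E `` {a} \<inter> N) \<union> {x})"
      using fin by (intro card_mono) auto
    also have "\<dots> \<le> card (br a) + card (E `` {a} \<inter> N) + card {x}"
      by (meson add_le_mono1 card_Un_le le_trans)
    finally show ?thesis
      using bspec[OF AB(5), of a] that small[OF \<open>a \<noteq> x\<close>] by (simp add: conv)
  qed
  have "(d + 1) * (d - 1) \<le> card (N \<inter> B') * (d - 1)"
    using bspec[OF AB(4) x] by (intro mult_right_mono) (auto simp: N_def)
  also have "\<dots> \<le> (\<Sum>a\<in>N \<inter> B'. card (br a))"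
    using sum_bounded_below[of "N \<inter> B'" "d - 1" "\<lambda>a. card (br a)"] card_br by simp
  also have "\<dots> = card N2"
    unfolding N2_def
  proof (rule card_UN_disjoint[symmetric])
    \<comment> \<open>A vertex in two branches would be a second common neighbour of
      \<open>a\<close> and \<open>b\<close> besides \<open>x\<close>.\<close>
    show "\<forall>a\<in>N \<inter> B'. \<forall>b\<in>N \<inter> B'. a \<noteq> b \<longrightarrow> br a \<inter> br b = {}"
    proof (intro ballI impI, rule ccontr)
      fix a b assume ab: "a \<in> N \<inter> B'" "b \<in> N \<inter> B'" "a \<noteq> b" "br a \<inter> br b \<noteq> {}"
      then obtain u where "(a, u) \<in> E" "(b, u) \<in> E" "u \<noteq> x"
        by (auto simp: br_def)
      then show False
        using common_nb_unique[of a u b x] ab adj_sym by (auto simp: N_def)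
    qed
  qed (use fin in auto)
  finally have card_N2: "(d + 1) * (d - 1) \<le> card N2" .
  have "4 * k * card V < card N2 * d"
    using d card_N2 by (meson less_le_trans mult_right_mono zero_le)
  also have "\<dots> \<le> (\<Sum>u\<in>N2. card (E `` {u} \<inter> Y))"
  proof -
    \<comment> \<open>More than \<open>d\<close> neighbours of \<open>u\<close> exist; none is
      \<open>x\<close>, and at most one lies in \<open>N\<close>.\<close>
    have "d \<le> card (E `` {u} \<inter> Y)" if "u \<in> N2" for u
    proof -
      have u: "u \<in> A'" "u \<noteq> x" "(u, x) \<notin> E"
        using that N2_sub adj_sym by (auto simp: N2_def br_def N_def)
      have "E `` {u} \<subseteq> (E `` {u} \<inter> Y) \<union> (E `` {u} \<inter> N)"
        using u nbs_sub by (auto simp: Y_def)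
      then have "card (E `` {u}) \<le> card ((E `` {u} \<inter> Y) \<union> (E `` {u} \<inter> N))"
        by (intro card_mono) auto
      also have "\<dots> \<le> card (E `` {u} \<inter> Y) + card (E `` {u} \<inter> N)"
        by (rule card_Un_le)
      finally have "card (E `` {u}) \<le> card (E `` {u} \<inter> Y) + 1"
        using small[OF u(2)] by simp
      moreover have "card (E `` {u} \<inter> B') \<le> card (E `` {u})"
        by (intro card_mono) auto
      ultimately show ?thesis
        using bspec[OF AB(4) u(1)] by simp
    qed
    then show ?thesis
      using sum_bounded_below[of N2 d "\<lambda>u. card (E `` {u} \<inter> Y)"] by simp
  qed
  also have "\<dots> = card (Sigma N2 (\<lambda>u. E `` {u} \<inter> Y))"
    using fin by simp
  also have "Sigma N2 (\<lambda>u. E `` {u} \<inter> Y) = R"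
    by (auto simp: R_def)
  finally have "4 * k * card V < card R" .
  \<comment> \<open>Both sides have at most \<open>card V\<close> vertices, so
    \<open>4 * k * card V\<close> arcs suffice for a core of minimum degree above
    \<open>2 * k\<close>, room for a path on fewer than \<open>2 * k\<close> vertices.\<close>
  moreover have "card N2 \<le> card V" "card Y \<le> card V"
    using N2_sub AB finite_V by (auto intro!: card_mono simp: Y_def)
  then have "2 * k * (card N2 + card Y) \<le> 2 * k * (card V + card V)"
    by (intro mult_left_mono add_mono) auto
  moreover have "2 * k * (card V + card V) = 4 * k * card V"
    by simp
  ultimately have "2 * k * (card N2 + card Y) < card R"
    by linarith
  moreover have "R \<subseteq> N2 \<times> Y"
    by (simp add: R_def)
  ultimately have "\<exists>P Q. P \<subseteq> N2 \<and> Q \<subseteq> Y \<and> P \<noteq> {} \<and>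
    (\<forall>p\<in>P. 2 * k < card (R `` {p} \<inter> Q)) \<and> (\<forall>q\<in>Q. 2 * k < card (R\<inverse> `` {q} \<inter> P))"
    by (intro bipartite_core fin)
  then obtain P Q where PQ: "P \<subseteq> N2" "Q \<subseteq> Y" "P \<noteq> {}"
    "\<forall>p\<in>P. 2 * k < card (R `` {p} \<inter> Q)" "\<forall>q\<in>Q. 2 * k < card (R\<inverse> `` {q} \<inter> P)"
    by (elim exE conjE) (rule that)
  obtain p where "p \<in> P"
    using PQ(3) by blast
  moreover from this have "p \<in> N2"
    using PQ(1) by blast
  ultimately obtain a where p: "p \<in> P" "a \<in> N \<inter> B'" "p \<in> br a"
    unfolding N2_def by blast
  \<comment> \<open>The path has \<open>2 * k - 3\<close> vertices; \<open>x\<close>,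
    \<open>a\<close> and \<open>b\<close> complete the cycle. As \<open>k > 2\<close>, its head is
    not adjacent to \<open>a\<close>, which will force \<open>a \<noteq> b\<close>.\<close>
  have "\<exists>ps. length ps = 2 * (k - 2) + 1 \<and> distinct ps \<and> successively (\<lambda>u v. (u, v) \<in> E) ps \<and>
    set ps \<subseteq> P \<union> Q \<and> last ps = p \<and> hd ps \<in> P \<and> (k - 2 > 0 \<longrightarrow> (a, hd ps) \<notin> E)"
  proof (rule alternating_path[where d = "2 * k"])
    show "P \<subseteq> V" "Q \<subseteq> V"
      using PQ N2_sub by (auto simp: Y_def)
    show "2 * k < card (E `` {p} \<inter> Q)" if "p \<in> P" for p
      using bspec[OF PQ(4) that] by (rule less_le_trans) (auto intro!: card_mono simp: R_def)
    show "2 * k < card (E `` {q} \<inter> P)" if "q \<in> Q" for q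
    proof -
      have "R\<inverse> `` {q} \<inter> P \<subseteq> E `` {q} \<inter> P"
        using adj_sym by (auto simp: R_def)
      then have "card (R\<inverse> `` {q} \<inter> P) \<le> card (E `` {q} \<inter> P)"
        by (intro card_mono) auto
      then show ?thesis
        using bspec[OF PQ(5) that] by simp
    qed
    show "p \<in> P" "a \<notin> Q"
      using p PQ by (auto simp: Y_def)
    show "2 * (k - 2) + 1 \<le> 2 * k"
      using k by simp
  qed
  then obtain ps where ps: "length ps = 2 * (k - 2) + 1" "distinct ps"
    "successively (\<lambda>u v. (u, v) \<in> E) ps" "set ps \<subseteq> P \<union> Q" "last ps = p" "hd ps \<in> P"
    "(a, hd ps) \<notin> E"
    using k by auto
  have "hd ps \<in> N2"
    using ps PQ by auto
  then obtain b where b: "b \<in> N \<inter> B'" "hd ps \<in> br b"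
    by (auto simp: N2_def)
  have "ps \<noteq> []"
    using ps(1) by auto
  \<comment> \<open>\<open>Y\<close> contains neither \<open>x\<close> nor a neighbour of
    \<open>x\<close>, so the path misses \<open>x\<close>, \<open>a\<close> and
    \<open>b\<close>.\<close>
  have avoid: "set ps \<subseteq> Y"
    using ps(4) PQ(1,2) N2_sub(2) by blast
  have "a \<noteq> b"
    using b ps(7) by (auto simp: br_def)
  have "is_cycle E (x # b # ps @ [a])"
    unfolding is_cycle_def
  proof (intro conjI)
    show "distinct (x # b # ps @ [a])"
      using ps(2) avoid \<open>a \<noteq> b\<close> p b adj_neq by (auto simp: Y_def N_def)
    show "successively (\<lambda>u v. (u, v) \<in> E) (x # b # ps @ [a])"
      using ps(3,5) p b \<open>ps \<noteq> []\<close> adj_sym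
      by (auto simp: successively_Cons successively_append_iff N_def br_def)
    show "(last (x # b # ps @ [a]), hd (x # b # ps @ [a])) \<in> E"
      using p adj_sym by (auto simp: N_def)
  qed
  moreover have "length (x # b # ps @ [a]) = 2 * k"
    using ps(1) k by simp
  ultimately show ?thesis
    by blast
qed

end

subsection \<open>Bounds on degree power sums\<close>

lemma power_split_square:
  fixes a :: "'a :: monoid_mult"
  assumes "2 \<le> r"
  shows "a ^ r = a ^ (r - 2) * a\<^sup>2"
  using assms by (metis le_add_diff_inverse2 power_add)

text \<open>Here \<open>N\<close> is n - 1, and the right-hand side is the value of F_n for even n,
  the smaller of the two formulas. For \<open>r = 2\<close> and \<open>t = 1\<close> the loss is
  about \<open>2 * N\<close>, so the gain \<open>4 * N\<close> must be offset by
  \<open>(N - 1) * 2 ^ r\<close>. For \<open>r \<ge> 3\<close> the loss is at least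
  \<open>t * N ^ (r - 1)\<close>.\<close>

lemma near_dominating_arith:
  fixes N t r :: nat
  assumes "2 \<le> r" "1 \<le> t" "4 * 3 ^ r * t \<le> N" "8 * 3 ^ r \<le> N"
  shows "(N - t) ^ r + (t + 2) ^ (r - 2) * (4 * N + 6 * t\<^sup>2) \<le> N ^ r + (N - 1) * 2 ^ r + 1"
proof (cases "r = 2")
  case True
  then have tN: "36 * t \<le> N" "72 \<le> N"
    using assms by auto
  then obtain M where M: "N = t + M"
    by (metis le_add_diff_inverse le_trans mult_le_mono1 nat_mult_1 one_le_numeral)
  have "35 * t * t \<le> t * M"
    using tN M by simp
  moreover have "3 \<le> t * M"
    using tN M assms(2) by (intro order_trans[OF _ mult_le_mono[of 1 t 3 M]]) auto
  ultimately have "5 * (t * t) + 3 \<le> 2 * (t * M)"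
    by linarith
  moreover have "N - 1 = t + M - 1" "1 \<le> t + M"
    using M tN by auto
  ultimately show ?thesis
    using True M by (simp add: power2_eq_square algebra_simps)
next
  case False
  define m where "m = r - 3"
  then have r: "r = m + 3"
    using False assms(1) by simp
  \<comment> \<open>The factor is \<open>3 ^ (r - 2)\<close>, which comes from
    \<open>t + 2 \<le> 3 * t\<close>.\<close>
  define p :: nat where "p = 3 ^ (m + 1)"
  have p: "3 ^ r = 9 * p" "1 \<le> p"
    by (simp_all add: p_def r power_add)
  have pt: "36 * (p * t) \<le> N" and p72: "72 * p \<le> N"
    using assms(3,4) p by simp_all
  have tN: "t \<le> N"
    using pt p(2) by (metis le_trans mult_le_mono1 nat_mult_1 one_le_numeral)
  have "(36 * (p * t)) * (36 * (p * t)) \<le> N * N"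
    by (intro mult_le_mono pt)
  moreover have "p * t * t \<le> p * t * (p * t)"
    using p(2) by simp
  moreover have "(36 * (p * t)) * (36 * (p * t)) = 1296 * (p * t * (p * t))"
    by simp
  ultimately have "1296 * (p * t * t) \<le> N * N"
    by linarith
  moreover have "72 * p * N \<le> N * N"
    using p72 by (intro mult_le_mono1)
  then have "72 * (p * N) \<le> N * N"
    by (simp only: mult.assoc)
  ultimately have "4 * (p * N) + 6 * (p * t * t) \<le> N * N"
    by linarith
  \<comment> \<open>The bound \<open>36 * (p * t) \<le> N\<close> controls the term quadratic in
    \<open>t\<close>, and \<open>72 * p \<le> N\<close> the term linear in \<open>N\<close>.\<close>
  then have key: "p * (4 * N + 6 * t\<^sup>2) \<le> N\<^sup>2"
    by (simp add: algebra_simps power2_eq_square)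
  have "(t + 2) ^ (r - 2) \<le> (3 * t) ^ (m + 1)"
  proof -
    have "r - 2 = m + 1"
      using r by simp
    then show ?thesis
      using assms(2) by (simp only:) (intro power_mono; simp)
  qed
  also have "\<dots> = p * t * t ^ m"
    by (simp only: power_mult_distrib p_def) simp
  also have "\<dots> \<le> p * t * N ^ m"
    by (intro mult_left_mono power_mono tN) auto
  finally have "(t + 2) ^ (r - 2) * (4 * N + 6 * t\<^sup>2) \<le> (p * t * N ^ m) * (4 * N + 6 * t\<^sup>2)"
    by (rule mult_le_mono1)
  also have "\<dots> = (t * N ^ m) * (p * (4 * N + 6 * t\<^sup>2))"
    by simp
  also have "\<dots> \<le> (t * N ^ m) * N\<^sup>2"
    by (rule mult_le_mono2[OF key])
  also have "\<dots> = t * N ^ (r - 1)"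
    by (simp add: r power_add power2_eq_square)
  finally have 1: "(t + 2) ^ (r - 2) * (4 * N + 6 * t\<^sup>2) \<le> t * N ^ (r - 1)" .
  have "r \<noteq> 0"
    using assms(1) by simp
  then have "(N - t) ^ r = (N - t) * (N - t) ^ (r - 1)"
    by (simp add: power_eq_if[of _ r])
  \<comment> \<open>Keeping one factor \<open>N - t\<close> and enlarging the others to
    \<open>N\<close> exhibits the loss \<open>t * N ^ (r - 1)\<close>.\<close>
  also have "\<dots> \<le> (N - t) * N ^ (r - 1)"
    by (intro mult_left_mono power_mono) auto
  finally have "(N - t) ^ r + t * N ^ (r - 1) \<le> ((N - t) + t) * N ^ (r - 1)"
    by (simp only: add_mult_distrib)
  also have "\<dots> = N ^ r"
    using tN \<open>r \<noteq> 0\<close> by (simp add: power_eq_if[of _ r])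
  finally show ?thesis
    using 1 by linarith
qed

context c4_free_graph
begin

text \<open>The bound is the value of F_n written out by parity. For \<open>t = 0\<close> the other
  degrees are at most two, with a deficient vertex for even order. For \<open>t > 0\<close>,
  splitting a square off \<open>deg v ^ r\<close> reduces to the second moment of the other
  degrees.\<close>

lemma sum_deg_power_le_near_dominating:
  assumes x: "x \<in> V" and r: "2 \<le> r" and t: "t = card V - 1 - deg x"
    and large: "4 * 3 ^ r * t \<le> card V - 1" "8 * 3 ^ r \<le> card V - 1"
  shows "(\<Sum>v\<in>V. deg v ^ r) \<le> (card V - 1) ^ r +
    (if odd (card V) then (card V - 1) * 2 ^ r else (card V - 2) * 2 ^ r + 1)"
proof -
  let ?n = "card V"
  have split: "(\<Sum>v\<in>V. deg v ^ r) = deg x ^ r + (\<Sum>v\<in>V - {x}. deg v ^ r)"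
    by (rule sum.remove[OF finite_V x])
  show ?thesis
  proof (cases "t = 0")
    case True
    then have degx: "deg x = ?n - 1"
      using t deg_le[OF x] by simp
    have le: "deg v ^ r \<le> 2 ^ r" if "v \<in> V - {x}" for v
      using deg_dominated(1)[OF x degx, of v] that by (intro power_mono) auto
    show ?thesis
    proof (cases "odd ?n")
      case True
      then show ?thesis
        using split degx sum_bounded_above[of "V - {x}" "\<lambda>v. deg v ^ r" "2 ^ r"] le x finite_V by simp
    next
      case False
      then obtain v where v: "v \<in> V - {x}" "deg v \<le> 1"
        using deg_dominated(2)[OF x degx] by blast
      have "(\<Sum>v\<in>V - {x}. deg v ^ r) = deg v ^ r + (\<Sum>v\<in>V - {x} - {v}. deg v ^ r)"
        using finite_V v by (intro sum.remove) auto
      also have "\<dots> \<le> 1 + card (V - {x} - {v}) * 2 ^ r"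
        using v(2) sum_bounded_above[of "V - {x} - {v}" "\<lambda>v. deg v ^ r" "2 ^ r"] le
        by (intro add_mono power_le_one) auto
      also have "card (V - {x} - {v}) = ?n - 2"
        using x v finite_V by simp
      finally show ?thesis
        using split degx False by simp
    qed
  next
    case False
    have "(\<Sum>v\<in>V - {x}. deg v ^ r) \<le> (\<Sum>v\<in>V - {x}. (t + 2) ^ (r - 2) * (deg v)\<^sup>2)"
    proof (rule sum_mono)
      fix v assume "v \<in> V - {x}"
      have "deg v ^ r = deg v ^ (r - 2) * (deg v)\<^sup>2"
        by (rule power_split_square[OF r])
      also have "\<dots> \<le> (t + 2) ^ (r - 2) * (deg v)\<^sup>2"
        using deg_near_dominating(1)[OF x t, of v] \<open>v \<in> V - {x}\<close>
        by (intro mult_right_mono power_mono) auto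
      finally show "deg v ^ r \<le> (t + 2) ^ (r - 2) * (deg v)\<^sup>2" .
    qed
    also have "\<dots> \<le> (t + 2) ^ (r - 2) * (4 * (?n - 1) + 6 * t\<^sup>2)"
      unfolding sum_distrib_left[symmetric]
      by (intro mult_left_mono deg_near_dominating(2)[OF x t]) auto
    finally have others: "(\<Sum>v\<in>V - {x}. deg v ^ r)
        \<le> (t + 2) ^ (r - 2) * (4 * (?n - 1) + 6 * t\<^sup>2)" .
    have "deg x = ?n - 1 - t"
      using t deg_le[OF x] by simp
    then have "(\<Sum>v\<in>V. deg v ^ r) = (?n - 1 - t) ^ r + (\<Sum>v\<in>V - {x}. deg v ^ r)"
      using split by (simp only:)
    also have "\<dots> \<le> (?n - 1 - t) ^ r + (t + 2) ^ (r - 2) * (4 * (?n - 1) + 6 * t\<^sup>2)"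
      by (rule add_left_mono[OF others])
    also have "\<dots> \<le> (?n - 1) ^ r + (?n - 1 - 1) * 2 ^ r + 1"
      using False r large by (intro near_dominating_arith) auto
    also have "\<dots> \<le> (?n - 1) ^ r + (if odd ?n then (?n - 1) * 2 ^ r else (?n - 2) * 2 ^ r + 1)"
    proof -
      have "?n - 1 = Suc (?n - 2)"
        using large(2) by (cases "?n - 1") auto
      then have "(?n - 2) * 2 ^ r + 1 \<le> (?n - 1) * 2 ^ r"
        by simp
      then show ?thesis
        by (simp add: numeral_2_eq_2)
    qed
    finally show ?thesis .
  qed
qed

text \<open>Bounding all but two factors by \<open>\<beta>\<close> leaves the second moment
  \<open>Q\<close>, at most n^2 + S for the degree sum \<open>S\<close>. Cauchy-Schwarz gives S^2
  \<le> Q n, and the crude bound S \<le> n^2 turns this into S^2 \<le> 2 n^3.\<close>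

lemma sum_deg_power_le_max_deg:
  fixes \<beta> :: real
  assumes r: "2 \<le> r" and \<beta>: "\<And>v. v \<in> V \<Longrightarrow> real (deg v) \<le> \<beta>"
  shows "(\<Sum>v\<in>V. real (deg v) ^ r) \<le> \<beta> ^ (r - 2) * (real (card V) ^ 2 + sqrt (2 * real (card V) ^ 3))"
proof (cases "V = {}")
  case False
  let ?n = "real (card V)"
  define S where "S = (\<Sum>v\<in>V. real (deg v))"
  define Q where "Q = (\<Sum>v\<in>V. (real (deg v))\<^sup>2)"
  have "\<beta> \<ge> 0"
    using \<beta> False by (metis all_not_in_conv of_nat_0_le_iff order_trans)
  have "real (\<Sum>v\<in>V. (deg v)\<^sup>2) \<le> real ((card V)\<^sup>2 + (\<Sum>v\<in>V. deg v))"
    using sum_deg_sq_le by (rule of_nat_mono)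
  then have QS: "Q \<le> ?n ^ 2 + S"
    by (simp add: Q_def S_def)
  have "real (deg v) \<le> ?n" if "v \<in> V" for v
    using deg_le[OF that] by simp
  then have "S \<le> ?n ^ 2"
    using sum_bounded_above[of V "\<lambda>v. real (deg v)" ?n] by (simp add: S_def power2_eq_square)
  have "S\<^sup>2 \<le> Q * ?n"
    unfolding S_def Q_def by (rule sum_squared_le_sum_of_squares)
  also have "\<dots> \<le> (2 * ?n ^ 2) * ?n"
    using QS \<open>S \<le> ?n ^ 2\<close> by (intro mult_right_mono) auto
  finally have "S\<^sup>2 \<le> 2 * ?n ^ 3"
    by (simp add: power2_eq_square power3_eq_cube)
  then have "S \<le> sqrt (2 * ?n ^ 3)"
    by (rule real_le_rsqrt)
  have "(\<Sum>v\<in>V. real (deg v) ^ r) \<le> (\<Sum>v\<in>V. \<beta> ^ (r - 2) * (real (deg v))\<^sup>2)"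
  proof (rule sum_mono)
    fix v assume "v \<in> V"
    have "real (deg v) ^ r = real (deg v) ^ (r - 2) * (real (deg v))\<^sup>2"
      by (rule power_split_square[OF r])
    also have "\<dots> \<le> \<beta> ^ (r - 2) * (real (deg v))\<^sup>2"
      using \<beta>[OF \<open>v \<in> V\<close>] by (intro mult_right_mono power_mono) auto
    finally show "real (deg v) ^ r \<le> \<beta> ^ (r - 2) * (real (deg v))\<^sup>2" .
  qed
  also have "\<dots> = \<beta> ^ (r - 2) * Q"
    by (simp add: Q_def sum_distrib_left)
  also have "\<dots> \<le> \<beta> ^ (r - 2) * (?n ^ 2 + sqrt (2 * ?n ^ 3))"
    using QS \<open>S \<le> sqrt (2 * ?n ^ 3)\<close> \<open>\<beta> \<ge> 0\<close> by (intro mult_left_mono) auto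
  finally show ?thesis .
qed simp

text \<open>Let \<open>X\<close> be this sum and \<open>A\<close> its index set, so
  \<open>card A \<le> X / D\<close>. Counted from the other end, \<open>X\<close> adds up the
  numbers of neighbours in \<open>A\<close>; Cauchy-Schwarz and \<open>second_moment\<close> give
  X^2 \<le> n (X^2 / D^2 + X), to be solved for \<open>X\<close>.\<close>

lemma sum_deg_high_le:
  fixes D :: real
  assumes D: "D > 0" "D\<^sup>2 > real (card V)"
  shows "(\<Sum>v\<in>{v \<in> V. real (deg v) > D}. real (deg v)) \<le> real (card V) / (1 - real (card V) / D\<^sup>2)"
proof -
  let ?n = "real (card V)"
  define A where "A = {v \<in> V. real (deg v) > D}"
  define X where "X = (\<Sum>v\<in>A. real (deg v))"
  have A: "A \<subseteq> V" "finite A"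
    using finite_V by (auto simp: A_def)
  have X: "X = (\<Sum>u\<in>V. real (card (E `` {u} \<inter> A)))"
    using arg_cong[OF sum_card_nbs_Int[OF A(1)], of real] by (simp add: X_def)
  have pos: "1 - ?n / D\<^sup>2 > 0"
    using D by (simp add: field_simps)
  have "X \<ge> 0"
    by (simp add: X_def sum_nonneg)
  have "real (card A) * D \<le> X"
    using sum_bounded_below[of A D "\<lambda>v. real (deg v)"] by (simp add: X_def A_def less_imp_le)
  then have "real (card A) \<le> X / D"
    using D by (simp add: field_simps)
  then have cardA: "(real (card A))\<^sup>2 \<le> X\<^sup>2 / D\<^sup>2"
    using power_mono[of "real (card A)" "X / D" 2] by (simp add: power_divide)
  have "real (\<Sum>u\<in>V. (card (E `` {u} \<inter> A))\<^sup>2) \<le> real ((card A)\<^sup>2 + (\<Sum>a\<in>A. deg a))"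
    using second_moment[OF A(1)] by (rule of_nat_mono)
  then have mom: "(\<Sum>u\<in>V. (real (card (E `` {u} \<inter> A)))\<^sup>2) \<le> (real (card A))\<^sup>2 + X"
    by (simp add: X_def)
  have "X\<^sup>2 \<le> (\<Sum>u\<in>V. (real (card (E `` {u} \<inter> A)))\<^sup>2) * ?n"
    unfolding X by (rule sum_squared_le_sum_of_squares)
  also have "\<dots> \<le> (X\<^sup>2 / D\<^sup>2 + X) * ?n"
    using mom cardA by (intro mult_right_mono) auto
  finally have "X * (X * (1 - ?n / D\<^sup>2)) \<le> X * ?n"
    by (simp add: algebra_simps power2_eq_square)
  then have "X * (1 - ?n / D\<^sup>2) \<le> ?n"
    using \<open>X \<ge> 0\<close> by (cases "X = 0") auto
  then have "X \<le> ?n / (1 - ?n / D\<^sup>2)"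
    using pos by (simp add: pos_le_divide_eq)
  then show ?thesis
    by (simp add: X_def A_def)
qed

text \<open>One factor of each square is bounded by \<open>\<beta>\<close> above the cut
  \<open>D\<close> and by \<open>D\<close> below it; sparseness can then be used on the low
  part.\<close>

lemma sum_deg_sq_le_split:
  fixes D \<beta> :: real
  assumes D: "D > 0" "D\<^sup>2 > real (card V)" and \<beta>: "\<beta> \<ge> 0" "\<And>v. v \<in> V \<Longrightarrow> real (deg v) \<le> \<beta>"
  shows "(\<Sum>v\<in>V. (real (deg v))\<^sup>2)
    \<le> \<beta> * (real (card V) / (1 - real (card V) / D\<^sup>2)) + D * (\<Sum>v\<in>V. real (deg v))"
proof -
  let ?A = "{v \<in> V. real (deg v) > D}"
  have "(\<Sum>v\<in>V. (real (deg v))\<^sup>2)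
      = (\<Sum>v\<in>V - ?A. (real (deg v))\<^sup>2) + (\<Sum>v\<in>?A. (real (deg v))\<^sup>2)"
    using finite_V by (intro sum.subset_diff) auto
  also have "(\<Sum>v\<in>V - ?A. (real (deg v))\<^sup>2) \<le> (\<Sum>v\<in>V - ?A. D * real (deg v))"
    by (intro sum_mono) (auto simp: power2_eq_square intro!: mult_right_mono)
  also have "\<dots> \<le> D * (\<Sum>v\<in>V. real (deg v))"
    unfolding sum_distrib_left using finite_V D by (intro sum_mono2) auto
  also have "(\<Sum>v\<in>?A. (real (deg v))\<^sup>2) \<le> (\<Sum>v\<in>?A. \<beta> * real (deg v))"
    using \<beta> by (intro sum_mono) (auto simp: power2_eq_square intro!: mult_right_mono)
  also have "\<dots> \<le> \<beta> * (real (card V) / (1 - real (card V) / D\<^sup>2))"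
    unfolding sum_distrib_left[symmetric] using sum_deg_high_le[OF D] \<beta>(1) by (intro mult_left_mono)
  finally show ?thesis
    by simp
qed

end

subsection \<open>Asymptotics\<close>

text \<open>After division by n^r the sides tend to \<open>c ^ (r - 2)\<close> and 1. As
  \<open>3 \<le> r\<close>, the exponent is positive and the first limit is below 1;
  \<open>m\<close> separates the two.\<close>

lemma eventually_second_moment_gap:
  fixes c :: real
  assumes "0 \<le> c" "c < 1" "3 \<le> r"
  shows "\<forall>\<^sub>F n in sequentially.
    (c * real n) ^ (r - 2) * (real n ^ 2 + sqrt (2 * real n ^ 3)) < (real n - 1) ^ r"
proof -
  have "1 \<le> r - 2"
    using assms(3) by linarith
  then have cr: "c ^ (r - 2) < 1"
    using assms power_decreasing[of 1 "r - 2" c] by simp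
  then obtain m where m: "c ^ (r - 2) < m" "m < 1"
    using dense by blast
  have "(\<lambda>n. c ^ (r - 2) * (1 + sqrt (2 / real n))) \<longlonglongrightarrow> c ^ (r - 2) * (1 + sqrt 0)"
    by (intro tendsto_intros)
  then have ev1: "\<forall>\<^sub>F n in sequentially. c ^ (r - 2) * (1 + sqrt (2 / real n)) < m"
    using m(1) by (intro order_tendstoD(2)) auto
  have "(\<lambda>n. ((real n - 1) / real n) ^ r) \<longlonglongrightarrow> 1 ^ r"
    by (intro tendsto_power) real_asymp
  then have ev2: "\<forall>\<^sub>F n in sequentially. m < ((real n - 1) / real n) ^ r"
    using m(2) by (intro order_tendstoD(1)) auto
  show ?thesis
    using ev1 ev2 eventually_gt_at_top[of 0]
  proof eventually_elim
    case (elim n)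
    have "sqrt (2 * real n ^ 3) = sqrt (real n ^ 4 * (2 / real n))"
      using elim(3) by (simp add: power4_eq_xxxx power3_eq_cube)
    also have "\<dots> = real n ^ 2 * sqrt (2 / real n)"
      using real_sqrt_abs[of "real n ^ 2"]
      by (simp only: real_sqrt_mult abs_power2 mult_2[symmetric] flip: power_mult) simp
    finally have "(c * real n) ^ (r - 2) * (real n ^ 2 + sqrt (2 * real n ^ 3))
        = (real n ^ (r - 2) * real n ^ 2) * (c ^ (r - 2) * (1 + sqrt (2 / real n)))"
      by (simp add: power_mult_distrib algebra_simps)
    also have "\<dots> < (real n ^ (r - 2) * real n ^ 2) * ((real n - 1) / real n) ^ r"
      using elim by (intro mult_strict_left_mono) auto
    also have "real n ^ (r - 2) * real n ^ 2 = real n ^ r"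
      using assms(3) power_split_square[of r "real n"] by simp
    finally show ?case
      using elim(3) by (simp add: power_divide)
  qed
qed

text \<open>The exponents balance: 2 * 0.55 > 1 makes the denominator tend to 1, and 0.55 + 0.4 < 1
  makes the second summand o(n^2). The \<open>+ 1\<close> allows for rounding n^0.4 up.\<close>

lemma eventually_sparse_gap:
  fixes c :: real
  assumes "c < 1"
  shows "\<forall>\<^sub>F n in sequentially. c * real n * (real n / (1 - real n / (real n powr 0.55)\<^sup>2))
    + real n powr 0.55 * (2 * (real n powr 0.4 + 1) * real n) < real n ^ 2"
proof -
  have "(\<lambda>n. c * (1 / (1 - real n / (real n powr 0.55)\<^sup>2))
      + real n powr 0.55 * (2 * (real n powr 0.4 + 1)) / real n) \<longlonglongrightarrow> c * 1 + 0"
    by (intro tendsto_intros) real_asymp+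
  then have "\<forall>\<^sub>F n in sequentially. c * (1 / (1 - real n / (real n powr 0.55)\<^sup>2))
      + real n powr 0.55 * (2 * (real n powr 0.4 + 1)) / real n < 1"
    using assms by (intro order_tendstoD(2)) auto
  then show ?thesis
    using eventually_gt_at_top[of 0]
  proof eventually_elim
    case (elim n)
    \<comment> \<open>For \<open>A = 0\<close> both quotients by \<open>A\<close> are 0, so the
      identity survives a vanishing denominator.\<close>
    have id: "c * x * (x / A) + B * (C * x) = x ^ 2 * (c * (1 / A) + B * C / x)" if "x \<noteq> 0"
      for x A B C :: real
      using that by (cases "A = 0") (simp_all add: power2_eq_square field_simps)
    have "c * real n * (real n / (1 - real n / (real n powr 0.55)\<^sup>2))
        + real n powr 0.55 * (2 * (real n powr 0.4 + 1) * real n)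
      = real n ^ 2 * (c * (1 / (1 - real n / (real n powr 0.55)\<^sup>2))
        + real n powr 0.55 * (2 * (real n powr 0.4 + 1)) / real n)"
      using elim(2) by (intro id) simp
    also have "\<dots> < real n ^ 2 * 1"
      using elim by (intro mult_strict_left_mono) auto
    finally show ?case
      by simp
  qed
qed

text \<open>Since 3 * 0.4 > 1, the right-hand side grows like n^1.2 and overtakes the linear
  left-hand side; rounding up only enlarges it.\<close>

lemma eventually_cycle_threshold:
  "\<forall>\<^sub>F n in sequentially. 4 * k * n < (nat \<lceil>real n powr 0.4\<rceil> + 1) * (nat \<lceil>real n powr 0.4\<rceil> - 1) * nat \<lceil>real n powr 0.4\<rceil>"
proof -
  have "(\<lambda>n. 4 * real k * (real n / ((real n powr 0.4 + 1) * (real n powr 0.4 - 1) * real n powr 0.4))) \<longlonglongrightarrow> 4 * real k * 0"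
    by (intro tendsto_intros) real_asymp
  then have ev1: "\<forall>\<^sub>F n in sequentially. 4 * real k * (real n / ((real n powr 0.4 + 1) * (real n powr 0.4 - 1) * real n powr 0.4)) < 1"
    by (intro order_tendstoD(2)) auto
  show ?thesis
    using ev1 eventually_gt_at_top[of 1]
  proof eventually_elim
    case (elim n)
    define y where "y = real n powr 0.4"
    define d where "d = nat \<lceil>y\<rceil>"
    have "y > 1"
      using elim(2) by (simp add: y_def gr_one_powr)
    then have "real d \<ge> y" "d \<ge> 1"
      by (auto simp: d_def le_nat_iff)
    have "4 * real k * real n < (y + 1) * (y - 1) * y"
    proof -
      have "(y + 1) * (y - 1) * y > 0"
        using \<open>y > 1\<close> by simp
      moreover have "4 * real k * real n / ((y + 1) * (y - 1) * y) < 1"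
        using elim(1) by (simp add: y_def)
      ultimately show ?thesis
        by (simp only: pos_divide_less_eq mult_1)
    qed
    also have "\<dots> \<le> (real d + 1) * (real d - 1) * real d"
      using \<open>y > 1\<close> \<open>real d \<ge> y\<close> by (intro mult_mono) auto
    also have "\<dots> = real ((d + 1) * (d - 1) * d)"
      using \<open>d \<ge> 1\<close> by (simp only: of_nat_mult of_nat_add of_nat_diff of_nat_1)
    finally have "real (4 * k * n) < real ((d + 1) * (d - 1) * d)"
      by simp
    then show ?case
      by (simp only: of_nat_less_iff d_def y_def)
  qed
qed

section \<open>The two extremal statements\<close>

text \<open>Such a degree leaves fewer than n / (8 * 3^r) vertices outside the closed neighbourhood
  of \<open>x\<close>, which is within the range of
  \<open>sum_deg_power_le_near_dominating\<close>.\<close>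

lemma degree_power_sum_le_friendship_if_high_degree:
  assumes G: "pair_graph G" "\<not> contains_copy G (cycle_graph 4)" "card (pverts G) = n"
    and r: "2 \<le> r" and large: "8 * 3 ^ r + 1 \<le> n"
    and x: "x \<in> pverts G" "real (card (parcs G `` {x})) > (1 - 1 / (8 * 3 ^ r)) * real n"
  shows "degree_power_sum r G \<le> degree_power_sum r (friendship_graph n)"
proof -
  interpret c4_free_graph "pverts G" "parcs G"
    using G by (intro c4_free_graphI)
  define t where "t = card (pverts G) - 1 - deg x"
  have "deg x \<le> n - 1"
    using deg_le[OF x(1)] G(3) by simp
  then have n: "real n = real t + real (deg x) + 1"
    using large G(3) by (simp add: t_def of_nat_diff)
  have "8 * 3 ^ r * real n = 8 * 3 ^ r * real t + 8 * 3 ^ r * real (deg x) + 8 * 3 ^ r"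
    unfolding n by (simp add: algebra_simps)
  moreover have "8 * 3 ^ r * real n - real n < 8 * 3 ^ r * real (deg x)"
    using x(2) by (simp add: field_simps)
  ultimately have "8 * 3 ^ r * real t < real n - 8 * 3 ^ r"
    by linarith
  then have "real (8 * 3 ^ r * t) < real n"
    by (simp add: less_le_trans)
  then have "8 * 3 ^ r * t < n"
    by (simp only: of_nat_less_iff)
  then have "4 * 3 ^ r * t \<le> n - 1"
    by simp
  moreover have "8 * 3 ^ r \<le> n - 1"
    using large by simp
  ultimately have "degree_power_sum r G \<le> (n - 1) ^ r + (if odd n then (n - 1) * 2 ^ r else (n - 2) * 2 ^ r + 1)"
    using sum_deg_power_le_near_dominating[OF x(1) r t_def] unfolding G(3) degree_power_sum_eq
    by blast
  then show ?thesis
    using degree_power_sum_friendship[of n r] large by (cases "odd n") auto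
qed

text \<open>If no degree exceeds \<open>c * n\<close>, the sum stays below
  \<open>(n - 1) ^ r\<close>, the contribution of the hub of F_n; otherwise the comparison around a
  vertex of high degree applies.\<close>

lemma ex_deg_C4_eq_friendship:
  assumes "3 \<le> r"
  shows "\<forall>\<^sub>F n in sequentially. ex_deg r n {cycle_graph 4} = degree_power_sum r (friendship_graph n)"
proof -
  define c :: real where "c = 1 - 1 / (8 * 3 ^ r)"
  have "1 \<le> (3 :: real) ^ r"
    by simp
  then have "1 \<le> 8 * (3 :: real) ^ r"
    by linarith
  then have c: "0 \<le> c" "c < 1"
    by (simp_all add: c_def field_simps)
  show ?thesis
    using eventually_second_moment_gap[OF c assms] eventually_ge_at_top[of "8 * 3 ^ r + 1"]
  proof eventually_elim
    case (elim n)
    show ?case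
    proof (rule ex_deg_eq_friendshipI)
      show "n > 0"
        using elim(2) by simp
      show "\<exists>l\<ge>4. F = cycle_graph l" if "F \<in> {cycle_graph 4}" for F
        using that by auto
      fix G :: "nat pair_pre_digraph"
      assume G: "pair_graph G" "card (pverts G) = n" "\<forall>F\<in>{cycle_graph 4}. \<not> contains_copy G F"
      then have C4: "\<not> contains_copy G (cycle_graph 4)"
        by simp
      interpret c4_free_graph "pverts G" "parcs G"
        using G(1) C4 by (rule c4_free_graphI)
      show "degree_power_sum r G \<le> degree_power_sum r (friendship_graph n)"
      proof (cases "\<exists>x\<in>pverts G. real (deg x) > c * real n")
        case True
        then show ?thesis
          using degree_power_sum_le_friendship_if_high_degree[OF G(1) C4 G(2) _ elim(2)] assms
          by (auto simp: c_def)
      next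
        case False
        have "real (degree_power_sum r G) = (\<Sum>v\<in>pverts G. real (deg v) ^ r)"
          by (simp add: degree_power_sum_eq)
        also have "\<dots> \<le> (c * real n) ^ (r - 2) * (real n ^ 2 + sqrt (2 * real n ^ 3))"
          using sum_deg_power_le_max_deg[of r "c * real n"] False assms G(2) by (simp add: not_less)
        also have "\<dots> < (real n - 1) ^ r"
          by (rule elim(1))
        also have "\<dots> = real ((n - 1) ^ r)"
          using elim(2) by (simp add: of_nat_diff)
        finally have "degree_power_sum r G < (n - 1) ^ r"
          by (simp only: of_nat_less_iff)
        then show ?thesis
          using degree_power_sum_friendship[of n r] elim(2) by (cases "odd n") auto
      qed
    qed
  qed
qed

text \<open>For \<open>r = 2\<close> the factor \<open>\<beta> ^ (r - 2)\<close> is 1, so small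
  maximum degree gains nothing there. Sparseness from the second forbidden cycle takes over: degrees
  are cut at n^0.55 and their total is O(n^1.4).\<close>

lemma ex_deg_C4_even_cycle_eq_friendship:
  assumes "2 < k"
  shows "\<forall>\<^sub>F n in sequentially.
    ex_deg 2 n {cycle_graph 4, cycle_graph (2 * k)} = degree_power_sum 2 (friendship_graph n)"
proof -
  define c :: real where "c = 1 - 1 / (8 * 3 ^ 2)"
  have c: "0 \<le> c" "c < 1"
    by (simp_all add: c_def)
  show ?thesis
    using eventually_sparse_gap[OF c(2)] eventually_cycle_threshold[of k] eventually_ge_at_top[of "8 * 3\<^sup>2 + 1"]
  proof eventually_elim
    case (elim n)
    define d where "d = nat \<lceil>real n powr 0.4\<rceil>"
    show ?case
    proof (rule ex_deg_eq_friendshipI)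
      show "n > 0"
        using elim(3) by simp
      show "\<exists>l\<ge>4. F = cycle_graph l" if "F \<in> {cycle_graph 4, cycle_graph (2 * k)}" for F
        using that assms by (auto intro: exI[of _ "2 * k"])
      fix G :: "nat pair_pre_digraph"
      assume G: "pair_graph G" "card (pverts G) = n"
        "\<forall>F\<in>{cycle_graph 4, cycle_graph (2 * k)}. \<not> contains_copy G F"
      then have C4: "\<not> contains_copy G (cycle_graph 4)"
        by simp
      interpret c4_free_graph "pverts G" "parcs G"
        using G(1) C4 by (rule c4_free_graphI)
      show "degree_power_sum 2 G \<le> degree_power_sum 2 (friendship_graph n)"
      proof (cases "\<exists>x\<in>pverts G. real (deg x) > c * real n")
        case True
        then show ?thesis
          using degree_power_sum_le_friendship_if_high_degree[OF G(1) C4 G(2) _ elim(3)]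
          by (auto simp: c_def)
      next
        case False
        have d: "real d \<le> real n powr 0.4 + 1"
          unfolding d_def using powr_ge_zero[of "real n" "0.4"] by linarith
        have "(\<Sum>v\<in>pverts G. deg v) \<le> 2 * d * n"
        proof (rule ccontr)
          assume "\<not> ?thesis"
          then obtain ps where "length ps = 2 * k" "is_cycle (parcs G) ps"
            using exists_even_cycle[OF assms, of d] elim(2) G(2) by (auto simp: d_def not_le)
          then have "contains_copy G (cycle_graph (2 * k))"
            using contains_copy_cycleI[OF G(1)] assms by fastforce
          then show False
            using G(3) by simp
        qed
        then have "real (\<Sum>v\<in>pverts G. deg v) \<le> real (2 * d * n)"
          by (rule of_nat_mono)
        also have "\<dots> = 2 * real d * real n"
          by simp
        also have "\<dots> \<le> 2 * (real n powr 0.4 + 1) * real n"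
          by (intro mult_left_mono mult_right_mono d) auto
        finally have S: "(\<Sum>v\<in>pverts G. real (deg v)) \<le> 2 * (real n powr 0.4 + 1) * real n"
          by simp
        have "real (degree_power_sum 2 G) = (\<Sum>v\<in>pverts G. (real (deg v))\<^sup>2)"
          by (simp add: degree_power_sum_eq)
        also have "\<dots> \<le> c * real n * (real n / (1 - real n / (real n powr 0.55)\<^sup>2))
            + real n powr 0.55 * (\<Sum>v\<in>pverts G. real (deg v))"
        proof -
          have "real n powr 1 < real n powr (0.55 + 0.55)"
            using elim(3) by (intro powr_less_mono) auto
          then have "(real n powr 0.55)\<^sup>2 > real n"
            by (simp only: power2_eq_square powr_add) simp
          moreover have "real n powr 0.55 > 0"
            using elim(3) by simp
          ultimately show ?thesis
            using sum_deg_sq_le_split[of "real n powr 0.55" "c * real n"] False G(2) c(1)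
            by (simp only: not_less bex_simps) simp
        qed
        also have "\<dots> \<le> c * real n * (real n / (1 - real n / (real n powr 0.55)\<^sup>2))
            + real n powr 0.55 * (2 * (real n powr 0.4 + 1) * real n)"
          by (intro add_left_mono mult_left_mono S) auto
        also have "\<dots> < real n ^ 2"
          by (rule elim(1))
        finally have "degree_power_sum 2 G < n ^ 2"
          by (simp only: of_nat_less_iff flip: of_nat_power)
        \<comment> \<open>The even-order value of F_n is n^2 + 2 n - 6, whence
          \<open>3 \<le> n\<close>.\<close>
        also have "n ^ 2 \<le> (n - 1) ^ 2 + (n - 2) * 2 ^ 2 + 1"
        proof -
          have "3 \<le> n"
            using elim(3) by simp
          then obtain m where "n = 3 + m"
            using le_Suc_ex by blast
          then show ?thesis
            by (simp add: power2_eq_square algebra_simps)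
        qed
        also have "\<dots> \<le> degree_power_sum 2 (friendship_graph n)"
          using degree_power_sum_friendship[of n 2] elim(3) by (cases "odd n") auto
        finally show ?thesis
          by simp
      qed
    qed
  qed
qed

theorem theorem1p6:
  shows "(\<forall>r::nat. r \<ge> 3 \<longrightarrow>
            (\<forall>\<^sub>F n in sequentially.
               ex_deg r n {cycle_graph 4} = degree_power_sum r (friendship_graph n)))
       \<and> (\<forall>k::nat. k > 2 \<longrightarrow>
            (\<forall>\<^sub>F n in sequentially.
               ex_deg 2 n {cycle_graph 4, cycle_graph (2 * k)}
                 = degree_power_sum 2 (friendship_graph n)))"
  using ex_deg_C4_eq_friendship ex_deg_C4_even_cycle_eq_friendship by blast

end
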